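(* Let $0<q<1$, let $s,x,y\in\mathbb{C}\setminus\{0\}$ with $|sxy|<1$, and let $n\in\mathbb{Z}$. Then $$\sum_{k=-\infty}^\infty s^k\,y^{n+k}\,\frac{(q^{n+k+1};q)_\infty}{(q;q)_\infty}\,{}_1\phi_1(0;q^{n+k+1};q,y^2)\;x^k\,\frac{(q^{k+1};q)_\infty}{(q;q)_\infty}\,{}_1\phi_1(0;q^{k+1};q,x^2)$$ is equal to $$y^n\,\frac{(s^{-1}xy^{-1};q)_n}{(q;q)_n}\,{}_2\phi_1\!\left[{s^{-1}yx^{-1},\;q^n s^{-1}xy^{-1}\atop q^{n+1}};q,sxy\right]\qquad\text{if } n\ge0,$$ and to $$s^{-n}x^{-n}\,\frac{(s^{-1}yx^{-1};q)_{-n}}{(q;q)_{-n}}\,{}_2\phi_1\!\left[{s^{-1}xy^{-1},\;q^{-n}s^{-1}yx^{-1}\atop q^{-n+1}};q,sxy\right]\qquad\text{if } n<0.$$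
   Context: For $0<q<1$ and $a\in\mathbb{C}$: $(a;q)_0:=1$, $(a;q)_k:=\prod_{j=0}^{k-1}(1-aq^j)$, $(a;q)_\infty:=\lim_{k\to\infty}(a;q)_k$. For $c\notin\{1,q^{-1},q^{-2},\dots\}$ and $|z|<1$, ${}_2\phi_1\!\left[{a,b\atop c};q,z\right]:=\sum_{k=0}^\infty\frac{(a;q)_k(b;q)_k}{(c;q)_k(q;q)_k}z^k$. For $w\notin\{1,q^{-1},q^{-2},\dots\}$, ${}_1\phi_1(0;w;q,z):=\sum_{k=0}^\infty\frac{(-1)^k q^{k(k-1)/2} z^k}{(w;q)_k\,(q;q)_k}$; for every $w,z\in\mathbb{C}$ (including $w=q^{-l}$, $l=0,1,2,\dots$) the product $(w;q)_\infty\,{}_1\phi_1(0;w;q,z)$ is interpreted as the entire function $\sum_{k=0}^\infty\frac{(-1)^kq^{k(k-1)/2}(q^kw;q)_\infty z^k}{(q;q)_k}$. *)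

theory Defs
  imports "HOL-Analysis.Analysis"
begin

definition qpoch :: "real \<Rightarrow> complex \<Rightarrow> nat \<Rightarrow> complex" where
  "qpoch q a k = (\<Prod>j<k. 1 - a * of_real q ^ j)"

definition qpoch_inf :: "real \<Rightarrow> complex \<Rightarrow> complex" where
  "qpoch_inf q a = lim (\<lambda>k. qpoch q a k)"

definition phi21 :: "complex \<Rightarrow> complex \<Rightarrow> complex \<Rightarrow> real \<Rightarrow> complex \<Rightarrow> complex" where
  "phi21 a b c q z =
     (\<Sum>k. qpoch q a k * qpoch q b k / (qpoch q c k * qpoch q (of_real q) k) * z ^ k)"

definition phi11_0 :: "complex \<Rightarrow> real \<Rightarrow> complex \<Rightarrow> complex" where
  "phi11_0 w q z =
     (\<Sum>k. (-1) ^ k * of_real q ^ (k * (k - 1) div 2) * z ^ k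
            / (qpoch q w k * qpoch q (of_real q) k))"

(* The product (w;q)_inf * 1phi1(0; w; q, z), read for every w, including the poles
   w = q^(-l) of the second factor, as an entire function of z.  Lemma phi11_0_reg_eq
   shows that it is the literal product whenever that product makes sense. *)
definition phi11_0_reg :: "complex \<Rightarrow> real \<Rightarrow> complex \<Rightarrow> complex" where
  "phi11_0_reg w q z =
     (\<Sum>k. (-1) ^ k * of_real q ^ (k * (k - 1) div 2) * qpoch_inf q (of_real q ^ k * w) * z ^ k
            / qpoch q (of_real q) k)"

lemma qpoch_tendsto:
  assumes "0 < q" "q < 1"
  shows "(\<lambda>k. qpoch q a k) \<longlonglongrightarrow> qpoch_inf q a"
proof -
  have "summable (\<lambda>j. norm (- a * of_real q ^ j))"
    using assms by (auto simp: norm_mult norm_power intro!: summable_mult summable_geometric)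
  then have "convergent_prod (\<lambda>j. 1 + (- a * of_real q ^ j))"
    by (intro abs_convergent_prod_imp_convergent_prod summable_imp_abs_convergent_prod) simp
  then have "convergent (\<lambda>n. \<Prod>j\<le>n. 1 + (- a * of_real q ^ j))"
    by (rule convergent_prod_imp_convergent)
  then have "convergent (\<lambda>n. qpoch q a (Suc n))"
    by (simp add: qpoch_def lessThan_Suc_atMost)
  then have "convergent (\<lambda>n. qpoch q a n)"
    by (simp only: convergent_Suc_iff)
  then show ?thesis
    by (simp add: qpoch_inf_def convergent_LIMSEQ_iff)
qed

lemma qpoch_inf_split:
  assumes "0 < q" "q < 1"
  shows "qpoch_inf q a = qpoch q a k * qpoch_inf q (of_real q ^ k * a)"
proof (rule LIMSEQ_unique)
  have *: "qpoch q a (m + k) = qpoch q a k * qpoch q (of_real q ^ k * a) m" for m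
    by (induction m) (simp_all add: qpoch_def power_add mult_ac)
  show "(\<lambda>m. qpoch q a (m + k)) \<longlonglongrightarrow> qpoch_inf q a"
    using qpoch_tendsto[OF assms] by (rule LIMSEQ_ignore_initial_segment)
  show "(\<lambda>m. qpoch q a (m + k)) \<longlonglongrightarrow> qpoch q a k * qpoch_inf q (of_real q ^ k * a)"
    unfolding * by (intro tendsto_mult tendsto_const qpoch_tendsto assms)
qed

lemma summable_phi11_0:
  assumes q: "0 < q" "q < 1" and w: "\<And>l. w * of_real q ^ l \<noteq> 1"
  shows "summable (\<lambda>k. (-1) ^ k * of_real q ^ (k * (k - 1) div 2) * z ^ k
                        / (qpoch q w k * qpoch q (of_real q) k))"
    (is "summable ?f")
proof -
  define r :: "nat \<Rightarrow> complex" where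
    "r k = - (of_real q ^ k * z) / ((1 - w * of_real q ^ k) * (1 - of_real q * of_real q ^ k))" for k
  have f_Suc: "?f (Suc k) = r k * ?f k" for k
  proof -
    have "Suc k * (Suc k - 1) div 2 = k + k * (k - 1) div 2"
      by (cases k) (simp_all add: algebra_simps)
    then have e: "of_real q ^ (Suc k * (Suc k - 1) div 2)
        = (of_real q ^ k * of_real q ^ (k * (k - 1) div 2) :: complex)"
      by (simp only: power_add)
    show ?thesis
      unfolding e r_def by (simp add: qpoch_def mult_ac)
  qed
  have pow: "(\<lambda>k. of_real q ^ k :: complex) \<longlonglongrightarrow> 0"
    using q by (intro LIMSEQ_power_zero) simp
  have "r \<longlonglongrightarrow> - (0 * z) / ((1 - w * 0) * (1 - of_real q * 0))"
    unfolding r_def by (intro tendsto_intros pow) simp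
  then have "r \<longlonglongrightarrow> 0" by simp
  then have "eventually (\<lambda>k. norm (r k) < 1/2) sequentially"
    by (auto simp: tendsto_iff dist_norm dest: spec[of _ "1/2"])
  then obtain N where N: "\<And>k. k \<ge> N \<Longrightarrow> norm (r k) < 1/2"
    by (auto simp: eventually_sequentially)
  show ?thesis
  proof (rule summable_ratio_test[of "1/2" N])
    fix k assume "k \<ge> N"
    have "norm (r k) * norm (?f k) \<le> 1/2 * norm (?f k)"
      using N[OF \<open>k \<ge> N\<close>] by (intro mult_right_mono) auto
    then show "norm (?f (Suc k)) \<le> 1/2 * norm (?f k)"
      unfolding f_Suc norm_mult .
  qed simp
qed

lemma phi11_0_reg_eq:
  assumes q: "0 < q" "q < 1" and w: "\<And>l. w * of_real q ^ l \<noteq> 1"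
  shows "phi11_0_reg w q z = qpoch_inf q w * phi11_0 w q z"
proof -
  have nz: "qpoch q w k \<noteq> 0" for k
    using w by (auto simp: qpoch_def)
  have eq: "(-1) ^ k * of_real q ^ (k * (k - 1) div 2) * qpoch_inf q (of_real q ^ k * w) * z ^ k
              / qpoch q (of_real q) k
          = qpoch_inf q w * ((-1) ^ k * of_real q ^ (k * (k - 1) div 2) * z ^ k
              / (qpoch q w k * qpoch q (of_real q) k))" for k
    unfolding qpoch_inf_split[OF q, of w k] using nz[of k] by simp
  show ?thesis
    unfolding phi11_0_reg_def phi11_0_def eq by (rule suminf_mult[OF summable_phi11_0[OF assms]])
qed

end

theory Submission
  imports Defs
begin

text \<open>
  The functions $J_k(x) = x^k (q^{k+1};q)_\infty\,{}_1\phi_1(0;q^{k+1};q,x^2)/(q;q)_\infty$ have the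
  generating function $\sum_k t^k J_k(x) = (x/t;q)_\infty / (xt;q)_\infty$, so the sum is the
  coefficient of $t^n$ in
  $\frac{(xt/s;q)_\infty}{(yt;q)_\infty} \cdot \frac{(y/t;q)_\infty}{(xs/t;q)_\infty}$ on the
  annulus $|xs| < |t| < 1/|y|$, and the $q$-binomial theorem expands each of the two quotients.
  The comparison of coefficients is done by grouping in two ways a single absolutely summable family
  of products $(xs)^m e_m \cdot y^i E_i \cdot y^p e_p \cdot (x/s)^j E_j$ with $p + j = n + m + i$,
  where $e$ and $E$ are the coefficients of $1/(z;q)_\infty$ and $(z;q)_\infty$: fixing $k = m - j$
  gives the Bessel side, fixing $m + i$ gives the ${}_2\phi_1$ side. The case $n < 0$ follows from
  $n > 0$ by exchanging $x$ and $y$ and shifting $k$.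
\<close>

section \<open>Products of absolutely summable families\<close>

lemma abs_summable_on_times:
  fixes f :: "'a \<Rightarrow> complex" and g :: "'b \<Rightarrow> complex"
  assumes "(\<lambda>a. norm (f a)) summable_on A" "(\<lambda>b. norm (g b)) summable_on B"
  shows "(\<lambda>z. norm (case z of (a, b) \<Rightarrow> f a * g b)) summable_on A \<times> B"
  using assms
  by (subst Infinite_Sum.abs_summable_on_Sigma_iff)
     (auto simp: norm_mult abs_mult infsum_cmult_right' intro!: summable_on_cmult_right summable_on_cmult_left)

text \<open>Absolute convergence gives the product family some sum \<open>S\<close>; summing over
  \<open>b\<close> first and then over \<open>a\<close> identifies \<open>S\<close>.\<close>

lemma has_sum_times:
  fixes f :: "'a \<Rightarrow> complex" and g :: "'b \<Rightarrow> complex"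
  assumes "(\<lambda>a. norm (f a)) summable_on A" "(\<lambda>b. norm (g b)) summable_on B"
    and "(f has_sum a) A" "(g has_sum b) B"
  shows "((\<lambda>(a, b). f a * g b) has_sum (a * b)) (A \<times> B)"
proof -
  obtain S where S: "((\<lambda>(a, b). f a * g b) has_sum S) (A \<times> B)"
    using abs_summable_summable[OF abs_summable_on_times[OF assms(1,2)]]
    by (auto simp: summable_on_def)
  have "((\<lambda>x. f x * b) has_sum S) A"
    by (rule has_sum_SigmaD[OF S]) (use assms(4) in \<open>auto intro!: has_sum_cmult_right\<close>)
  then have "S = a * b"
    using has_sum_cmult_left[OF assms(3)] has_sum_unique by blast
  with S show ?thesis by simp
qed

section \<open>q-shifted factorials and the coefficients of Euler's two q-exponentials\<close>

lemma qpoch_0 [simp]: "qpoch q a 0 = 1"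
  by (simp add: qpoch_def)

lemma qpoch_Suc: "qpoch q a (Suc k) = qpoch q a k * (1 - a * of_real q ^ k)"
  by (simp add: qpoch_def)

lemma qpoch_add: "qpoch q a (m + k) = qpoch q a m * qpoch q (of_real q ^ m * a) k"
  by (induction k) (simp_all add: qpoch_Suc power_add mult_ac)

text \<open>This is e of the overview; \<open>qExp_coeff\<close> below is E.\<close>

definition qexp_coeff :: "real \<Rightarrow> nat \<Rightarrow> complex" where
  "qexp_coeff q m = 1 / qpoch q (of_real q) m"

definition qExp_coeff :: "real \<Rightarrow> nat \<Rightarrow> complex" where
  "qExp_coeff q j = (-1) ^ j * of_real q ^ (j * (j - 1) div 2) / qpoch q (of_real q) j"

text \<open>Up to normalisation, the Hahn-Exton q-Bessel function of integer order. The regularised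
  product covers \<open>k < 0\<close>, where the lower parameter of the series is a pole.\<close>

definition qbessel :: "real \<Rightarrow> int \<Rightarrow> complex \<Rightarrow> complex" where
  "qbessel q k x =
     x powi k * (phi11_0_reg (of_real q powi (k + 1)) q (x\<^sup>2) / qpoch_inf q (of_real q))"

context
  fixes q :: real
  assumes q: "0 < q" "q < 1"
begin

lemma one_minus_q_power_nonzero: "1 - (of_real q :: complex) ^ Suc j \<noteq> 0"
proof
  assume "1 - (of_real q :: complex) ^ Suc j = 0"
  then have "q ^ Suc j = 1"
    by (metis eq_iff_diff_eq_0 of_real_eq_1_iff of_real_power)
  moreover have "q ^ Suc j < 1"
    using q by (intro power_Suc_less_one) auto
  ultimately show False by simp
qed

lemma qpoch_q_nonzero: "qpoch q (of_real q) k \<noteq> 0"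
  using one_minus_q_power_nonzero by (simp add: qpoch_def)

text \<open>Absolute convergence yields \<open>convergent_prod\<close>, which is stronger than
  convergence of the partial products: without zero factors the limit cannot be 0.\<close>

lemma qpoch_inf_q_nonzero: "qpoch_inf q (of_real q) \<noteq> 0"
proof -
  define f :: "nat \<Rightarrow> complex" where "f j = 1 - of_real q * of_real q ^ j" for j
  have "summable (\<lambda>j. norm (- of_real q * of_real q ^ j :: complex))"
    using q by (auto simp: norm_mult norm_power intro!: summable_mult summable_geometric)
  then have "convergent_prod (\<lambda>j. 1 + (- of_real q * of_real q ^ j :: complex))"
    by (intro abs_convergent_prod_imp_convergent_prod summable_imp_abs_convergent_prod) simp
  then have "convergent_prod f" by (simp add: f_def[abs_def])
  moreover have "f j \<noteq> 0" for j
    using one_minus_q_power_nonzero[of j] by (simp add: f_def)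
  ultimately have "prodinf f \<noteq> 0" "prodinf f = lim (\<lambda>n. \<Prod>i<n. f i)"
    using prodinf_nonzero prodinf_eq_lim' by blast+
  then show ?thesis by (simp add: qpoch_inf_def qpoch_def f_def)
qed

lemma qexp_coeff_eq:
  "qexp_coeff q m = qpoch_inf q (of_real q ^ Suc m) / qpoch_inf q (of_real q)"
  using qpoch_inf_split[OF q, of "of_real q" m] qpoch_q_nonzero[of m] qpoch_inf_q_nonzero
  by (auto simp: qexp_coeff_def field_simps)

lemma Bseq_qexp_coeff: "Bseq (qexp_coeff q)"
proof -
  have "(\<lambda>m. 1 / qpoch q (of_real q) m) \<longlonglongrightarrow> 1 / qpoch_inf q (of_real q)"
    by (intro tendsto_intros qpoch_tendsto q qpoch_inf_q_nonzero)
  then show ?thesis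
    unfolding qexp_coeff_def[abs_def] by (intro convergent_imp_Bseq convergentI)
qed

lemma abs_summable_qExp: "(\<lambda>j. norm (z ^ j * qExp_coeff q j)) summable_on UNIV"
proof -
  \<comment> \<open>Any point of modulus larger than that of \<open>z\<close> would do: convergence
    of the power series there gives absolute convergence at \<open>z\<close>. At \<open>Z\<close> it
    is the \<open>phi11_0\<close> series with \<open>w = 0\<close>, up to sign of the argument
    conventions already built into \<open>qExp_coeff\<close>.\<close>
  define Z :: complex where "Z = of_real (norm z + 1)"
  have "summable (\<lambda>j. qExp_coeff q j * Z ^ j)"
    using summable_phi11_0[OF q, of 0 Z]
    by (simp add: qExp_coeff_def qpoch_def mult_ac)
  moreover have "norm z < norm Z" by (simp add: Z_def del: of_real_add)
  ultimately have "summable (\<lambda>j. norm (qExp_coeff q j * z ^ j))"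
    by (rule powser_insidea)
  then show ?thesis
    by (subst summable_on_UNIV_nonneg_real_iff) (auto simp: mult_ac)
qed

lemma abs_summable_qexp:
  assumes "norm z < 1"
  shows "(\<lambda>m. norm (z ^ m * qexp_coeff q m)) summable_on UNIV"
proof -
  obtain M where M: "\<And>m. norm (qexp_coeff q m) \<le> M"
    using Bseq_qexp_coeff by (auto simp: Bseq_def)
  have "summable (\<lambda>m. norm (z ^ m * qexp_coeff q m))"
  proof (rule summable_comparison_test')
    show "summable (\<lambda>m. norm z ^ m * M)"
      using assms by (intro summable_mult2 summable_geometric) auto
    show "norm (norm (z ^ m * qexp_coeff q m)) \<le> norm z ^ m * M" if "m \<ge> 0" for m
      using M[of m] by (auto simp: norm_mult norm_power intro!: mult_left_mono)
  qed
  then show ?thesis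
    by (subst summable_on_UNIV_nonneg_real_iff) auto
qed

section \<open>The finite q-binomial theorem\<close>

lemma qexp_coeff_Suc:
  "(1 - of_real q ^ Suc m) * qexp_coeff q (Suc m) = qexp_coeff q m"
  using one_minus_q_power_nonzero[of m] by (simp add: qexp_coeff_def qpoch_Suc)

lemma qExp_coeff_Suc:
  "(1 - of_real q ^ Suc j) * qExp_coeff q (Suc j) = - (of_real q ^ j * qExp_coeff q j)"
proof -
  have "Suc j * (Suc j - 1) div 2 = j + j * (j - 1) div 2"
    by (cases j) (simp_all add: algebra_simps)
  then have e: "of_real q ^ (Suc j * (Suc j - 1) div 2)
      = (of_real q ^ j * of_real q ^ (j * (j - 1) div 2) :: complex)"
    by (simp only: power_add)
  show ?thesis
    unfolding qExp_coeff_def e using one_minus_q_power_nonzero[of j]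
    by (simp add: qpoch_Suc)
qed

text \<open>Both sides are the coefficient of \<open>z^A\<close> in
  \<open>(az;q)_inf / (z;q)_inf\<close>. In the induction, multiplying the sum for
  \<open>Suc A\<close> by \<open>1 - q^(A+1)\<close> yields \<open>1 - a q^A\<close> times the sum
  for \<open>A\<close>, which is also the recurrence of the right side.\<close>

lemma finite_q_binomial:
  "(\<Sum>j\<le>A. qExp_coeff q j * qexp_coeff q (A - j) * a ^ j) = qpoch q a A * qexp_coeff q A"
proof (induction A)
  case 0
  then show ?case by (simp add: qExp_coeff_def)
next
  case (Suc A)
  let ?Q = "of_real q :: complex"
  let ?S = "\<lambda>A. \<Sum>j\<le>A. qExp_coeff q j * qexp_coeff q (A - j) * a ^ j"
  \<comment> \<open>The two parts lower the index of \<open>qexp_coeff\<close> and of \<open>qExp_coeff\<close> respectively.\<close>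
  have split: "1 - ?Q ^ Suc A = (1 - ?Q ^ (Suc A - j)) + ?Q ^ (Suc A - j) * (1 - ?Q ^ j)"
    if "j \<le> Suc A" for j
    using that by (simp add: algebra_simps flip: power_add)
  have "(1 - ?Q ^ Suc A) * ?S (Suc A) =
      (\<Sum>j\<le>Suc A. (1 - ?Q ^ (Suc A - j)) * (qExp_coeff q j * qexp_coeff q (Suc A - j) * a ^ j))
    + (\<Sum>j\<le>Suc A. ?Q ^ (Suc A - j) * (1 - ?Q ^ j) *
          (qExp_coeff q j * qexp_coeff q (Suc A - j) * a ^ j))"
    unfolding sum_distrib_left sum.distrib[symmetric] distrib_right[symmetric]
    by (intro sum.cong refl) (metis atMost_iff split)
  \<comment> \<open>The term \<open>j = Suc A\<close> drops out because its factor is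
    \<open>1 - q^0\<close>; in the second sum the term \<open>j = 0\<close> drops out likewise,
    which permits the index shift.\<close>
  also have "(\<Sum>j\<le>Suc A. (1 - ?Q ^ (Suc A - j)) * (qExp_coeff q j * qexp_coeff q (Suc A - j) * a ^ j))
      = (\<Sum>j\<le>A. (1 - ?Q ^ Suc (A - j)) * (qExp_coeff q j * qexp_coeff q (Suc (A - j)) * a ^ j))"
    by (subst sum.atMost_Suc) (simp add: Suc_diff_le del: power_Suc)
  also have "\<dots> = (\<Sum>j\<le>A. qExp_coeff q j * ((1 - ?Q ^ Suc (A - j)) * qexp_coeff q (Suc (A - j))) * a ^ j)"
    by (simp only: mult_ac)
  also have "\<dots> = ?S A"
    by (simp only: qexp_coeff_Suc)
  also have "(\<Sum>j\<le>Suc A. ?Q ^ (Suc A - j) * (1 - ?Q ^ j) *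
          (qExp_coeff q j * qexp_coeff q (Suc A - j) * a ^ j))
      = (\<Sum>j\<le>A. ?Q ^ (A - j) * ((1 - ?Q ^ Suc j) * qExp_coeff q (Suc j)) *
          qexp_coeff q (A - j) * a ^ Suc j)"
    by (subst sum.atMost_Suc_shift) (simp add: mult_ac del: power_Suc)
  also have "\<dots> = (\<Sum>j\<le>A. - (a * ?Q ^ A) * (qExp_coeff q j * qexp_coeff q (A - j) * a ^ j))"
  proof (intro sum.cong refl)
    fix j assume "j \<in> {..A}"
    then have "?Q ^ A = ?Q ^ (A - j) * ?Q ^ j"
      by (simp flip: power_add)
    then show "?Q ^ (A - j) * ((1 - ?Q ^ Suc j) * qExp_coeff q (Suc j)) * qexp_coeff q (A - j) * a ^ Suc j
        = - (a * ?Q ^ A) * (qExp_coeff q j * qexp_coeff q (A - j) * a ^ j)"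
      unfolding qExp_coeff_Suc by simp
  qed
  also have "\<dots> = - (a * ?Q ^ A) * ?S A"
    by (rule sum_distrib_left[symmetric])
  finally have "(1 - ?Q ^ Suc A) * ?S (Suc A) = (1 - a * ?Q ^ A) * ?S A"
    by (simp add: left_diff_distrib del: sum.atMost_Suc power_Suc)
  also have "\<dots> = qpoch q a (Suc A) * ((1 - ?Q ^ Suc A) * qexp_coeff q (Suc A))"
    unfolding Suc.IH qexp_coeff_Suc by (simp add: qpoch_Suc)
  finally show ?case
    using one_minus_q_power_nonzero[of A] by (simp del: power_Suc sum.atMost_Suc)
qed

text \<open>The case \<open>a = v / u\<close>, scaled by \<open>u^A\<close>; summing over the
  antidiagonal lets it serve as an inner sum of a larger family.\<close>

lemma finite_q_binomial_homogeneous: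
  assumes "u \<noteq> 0"
  shows "((\<lambda>(m, j). u ^ m * qexp_coeff q m * (v ^ j * qExp_coeff q j)) has_sum
           u ^ A * qpoch q (v / u) A * qexp_coeff q A) {(m, j). m + j = A}"
proof -
  have "((\<lambda>j. u ^ A * (qExp_coeff q j * qexp_coeff q (A - j) * (v / u) ^ j)) has_sum
      (\<Sum>j\<le>A. u ^ A * (qExp_coeff q j * qexp_coeff q (A - j) * (v / u) ^ j))) {..A}"
    by (rule has_sum_finite) simp
  also have "(\<Sum>j\<le>A. u ^ A * (qExp_coeff q j * qexp_coeff q (A - j) * (v / u) ^ j))
      = u ^ A * qpoch q (v / u) A * qexp_coeff q A"
    by (simp add: finite_q_binomial flip: sum_distrib_left)
  also have "((\<lambda>j. u ^ A * (qExp_coeff q j * qexp_coeff q (A - j) * (v / u) ^ j)) has_sum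
        u ^ A * qpoch q (v / u) A * qexp_coeff q A) {..A} \<longleftrightarrow> ?thesis"
    using assms
    by (intro has_sum_reindex_bij_witness[of _ snd "\<lambda>j. (A - j, j)"])
       (auto simp: power_divide power_diff)
  finally show ?thesis .
qed

section \<open>q-Bessel functions as sums along diagonals\<close>

lemma qpoch_inf_eq_0:
  assumes "a * of_real q ^ l = 1"
  shows "qpoch_inf q a = 0"
  using qpoch_inf_split[OF q, of a "Suc l"] assms by (simp add: qpoch_Suc)

text \<open>On the diagonal put \<open>m = k + j\<close>: the coefficients
  \<open>qexp_coeff q m\<close> are bounded and the remaining factor is a term of the everywhere
  convergent series of \<open>qExp_coeff\<close> at \<open>x^2\<close>.\<close>

lemma qbessel_has_sum:
  assumes "x \<noteq> 0"
  defines "f \<equiv> \<lambda>(m, j). x ^ m * qexp_coeff q m * (x ^ j * qExp_coeff q j)"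
  shows "(\<lambda>z. norm (f z)) summable_on {(m, j). int m - int j = k}"
    and "(f has_sum qbessel q k x) {(m, j). int m - int j = k}"
proof -
  let ?D = "{(m, j). int m - int j = k}"
  let ?J = "{j. k + int j \<ge> 0}"
  define h where "h j = x powi k * ((x\<^sup>2) ^ j * qExp_coeff q j) * qexp_coeff q (nat (k + int j))" for j
  have f_h: "f (nat (k + int j), j) = h j" if "j \<in> ?J" for j
  proof -
    have "x ^ nat (k + int j) = x powi k * x ^ j"
      using that assms(1) by (simp add: power_int_add flip: power_int_of_nat)
    then show ?thesis
      by (simp add: f_def h_def power2_eq_square power_mult_distrib mult_ac)
  qed
  obtain M where M: "\<And>m. norm (qexp_coeff q m) \<le> M"
    using Bseq_qexp_coeff by (auto simp: Bseq_def)
  have "(\<lambda>z. norm (h z)) summable_on UNIV"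
  proof (rule summable_on_comparison_test)
    show "(\<lambda>j. norm (x powi k) * norm ((x\<^sup>2) ^ j * qExp_coeff q j) * M) summable_on UNIV"
      by (intro summable_on_cmult_left summable_on_cmult_right abs_summable_qExp)
    show "norm (h j) \<le> norm (x powi k) * norm ((x\<^sup>2) ^ j * qExp_coeff q j) * M" for j
      unfolding h_def norm_mult by (intro mult_left_mono M) auto
  qed auto
  then have h: "(\<lambda>z. norm (h z)) summable_on ?J"
    by (rule summable_on_subset_banach) auto
  also have "(\<lambda>z. norm (h z)) summable_on ?J \<longleftrightarrow> (\<lambda>z. norm (f z)) summable_on ?D"
    using f_h
    by (intro summable_on_reindex_bij_witness[of _ snd "\<lambda>j. (nat (k + int j), j)"]) force+
  finally show "(\<lambda>z. norm (f z)) summable_on ?D" .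

  define g where "g j = x powi k * ((-1) ^ j * of_real q ^ (j * (j - 1) div 2)
      * qpoch_inf q (of_real q ^ j * of_real q powi (k + 1)) * (x\<^sup>2) ^ j
      / qpoch q (of_real q) j / qpoch_inf q (of_real q))" for j
  \<comment> \<open>\<open>g\<close> is the Bessel series over all \<open>j\<close>. Outside
    \<open>?J\<close> the value of \<open>nat (k + int j)\<close> defaults to 0, so \<open>h\<close>
    is meaningless there, while \<open>g\<close> vanishes because \<open>(q^(j+k+1);q)_inf\<close>
    contains a zero factor.\<close>
  have g_h: "g j = (if j \<in> ?J then h j else 0)" for j
  proof (cases "j \<in> ?J")
    case True
    have "of_real q ^ j * of_real q powi (k + 1) = (of_real q :: complex) powi (int j + (k + 1))"
      using q by (simp add: power_int_add)
    also have "int j + (k + 1) = int (Suc (nat (k + int j)))"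
      using True by simp
    finally have "of_real q ^ j * of_real q powi (k + 1) = (of_real q :: complex) ^ Suc (nat (k + int j))"
      by (simp only: power_int_of_nat)
    then show ?thesis
      using True by (simp add: g_def h_def qExp_coeff_def qexp_coeff_eq)
  next
    case False
    have "of_real q ^ j * of_real q powi (k + 1) * (of_real q :: complex) ^ nat (- (int j + (k + 1)))
        = of_real q powi (int j + (k + 1) + int (nat (- (int j + (k + 1)))))"
      using q by (simp add: power_int_add del: int_nat_eq)
    also have "\<dots> = 1" using False by simp
    finally show ?thesis
      using False by (simp add: g_def qpoch_inf_eq_0)
  qed
  have "summable (\<lambda>j. norm (g j))"
  proof -
    have "(\<lambda>z. norm (g z)) summable_on UNIV \<longleftrightarrow> (\<lambda>z. norm (h z)) summable_on ?J"
      by (rule summable_on_cong_neutral) (auto simp: g_h)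
    with h show ?thesis
      by (simp add: summable_on_UNIV_nonneg_real_iff)
  qed
  then have g: "(g has_sum suminf g) UNIV"
    by (intro norm_summable_imp_has_sum summable_sums) (auto dest: summable_norm_cancel)
  have "suminf g = qbessel q k x"
  proof -
    define c where "c = x powi k / qpoch_inf q (of_real q)"
    have c: "c \<noteq> 0"
      using assms(1) qpoch_inf_q_nonzero by (simp add: c_def)
    define r where "r j = (-1) ^ j * of_real q ^ (j * (j - 1) div 2)
      * qpoch_inf q (of_real q ^ j * of_real q powi (k + 1)) * (x\<^sup>2) ^ j
      / qpoch q (of_real q) j" for j
    have gr: "g = (\<lambda>j. c * r j)"
      by (auto simp: g_def c_def r_def)
    have "summable g"
      using \<open>summable (\<lambda>j. norm (g j))\<close> by (rule summable_norm_cancel)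
    then have "summable r"
      using c by (simp add: gr summable_cmult_iff)
    then have "suminf g = c * suminf r"
      unfolding gr by (rule suminf_mult)
    then show ?thesis
      by (simp add: c_def qbessel_def phi11_0_reg_def r_def[abs_def])
  qed
  with g have "(g has_sum qbessel q k x) UNIV" by simp
  also have "(g has_sum qbessel q k x) UNIV \<longleftrightarrow> (h has_sum qbessel q k x) ?J"
    by (rule has_sum_cong_neutral) (auto simp: g_h)
  also have "\<dots> \<longleftrightarrow> (f has_sum qbessel q k x) ?D"
    using f_h
    by (intro has_sum_reindex_bij_witness[of _ snd "\<lambda>j. (nat (k + int j), j)"]) force+
  finally show "(f has_sum qbessel q k x) ?D" .
qed

section \<open>Grouping one family in two ways, for nonnegative order\<close>

lemma qbessel_convolution_nat:
  assumes nz: "s \<noteq> 0" "x \<noteq> 0" "y \<noteq> 0" and sxy: "norm (s * x * y) < 1"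
  shows "((\<lambda>k. s powi k * (qbessel q k x * qbessel q (int N + k) y)) has_sum
           y ^ N * (qpoch q (x / s / y) N / qpoch q (of_real q) N)
             * phi21 (y / (x * s)) (of_real q ^ N * (x / s / y)) (of_real q ^ Suc N) q (s * x * y)) UNIV"
proof -
  \<comment> \<open>The annulus of the generating functions is nonempty.\<close>
  have "norm (x * s) < 1 / norm y"
    using nz sxy by (simp add: field_simps norm_mult)
  then obtain t' where t': "norm (x * s) < t'" "t' < 1 / norm y"
    using dense by blast
  \<comment> \<open>Since \<open>p + j = N + m + i\<close>, rescaling by \<open>t\<close> changes each term of the family by the factor
    \<open>t ^ N\<close> only, and makes all four factors summable.\<close>
  define t :: complex where "t = of_real t'"
  have "t' > 0" using t'(1) norm_ge_zero[of "x * s"] by linarith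
  then have t: "t \<noteq> 0" "norm (x * s / t) < 1" "norm (y * t) < 1"
    using t' nz by (auto simp: t_def norm_divide norm_mult field_simps)

  define H where "H = (\<lambda>((m, i), (p, j)).
    ((x * s) ^ m * qexp_coeff q m * (y ^ i * qExp_coeff q i)) *
    (y ^ p * qexp_coeff q p * ((x / s) ^ j * qExp_coeff q j)))"
  define G where "G = (\<lambda>((m, i), (p, j)).
    ((x * s / t) ^ m * qexp_coeff q m * ((y / t) ^ i * qExp_coeff q i)) *
    ((y * t) ^ p * qexp_coeff q p * ((x / s * t) ^ j * qExp_coeff q j)))"
  \<comment> \<open>Both sets encode \<open>p + j = N + m + i\<close>: \<open>S1\<close> groups by
    \<open>k = m - j\<close>, \<open>S2\<close> by \<open>C = m + i\<close>. The group index is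
    determined by the other entries, so \<open>snd\<close> is injective on
    \<open>S2\<close>.\<close>
  define S1 where "S1 = Sigma UNIV (\<lambda>k. {(m, j). int m - int j = k} \<times> {(p, i). int p - int i = int N + k})"
  define S2 where "S2 = Sigma UNIV (\<lambda>C. {(m, i). m + i = C} \<times> {(p, j). p + j = N + C})"

  have "(\<lambda>z. norm (G z)) summable_on UNIV"
    using abs_summable_on_times[OF
      abs_summable_on_times[OF abs_summable_qexp[OF t(2)] abs_summable_qExp[of "y / t"]]
      abs_summable_on_times[OF abs_summable_qexp[OF t(3)] abs_summable_qExp[of "x / s * t"]]]
    by (simp add: G_def case_prod_unfold)
  then have "(\<lambda>z. norm (G z)) summable_on (snd ` S2)"
    by (rule summable_on_subset_banach) auto
  also have "?this \<longleftrightarrow> ((\<lambda>z. norm (G z)) \<circ> snd) summable_on S2"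
    by (rule summable_on_reindex) (auto simp: S2_def inj_on_def)
  finally have "(\<lambda>w. norm (1 / t ^ N) * norm (G (snd w))) summable_on S2"
    by (intro summable_on_cmult_right) (simp add: o_def)
  also have "?this \<longleftrightarrow> (\<lambda>w. norm (H (snd w))) summable_on S2"
  proof (rule summable_on_cong)
    fix w assume "w \<in> S2"
    then obtain m i p j where w: "w = (m + i, (m, i), (p, j))" "p + j = N + m + i"
      by (auto simp: S2_def)
    have "t ^ p * t ^ j = t ^ N * t ^ m * t ^ i"
      using w(2) by (simp flip: power_add)
    moreover have "G (snd w) = (t ^ p * t ^ j / (t ^ m * t ^ i)) * H (snd w)"
      by (simp add: w(1) G_def H_def power_divide power_mult_distrib mult_ac)
    ultimately have "G (snd w) = t ^ N * H (snd w)"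
      using t(1) by simp
    then show "norm (1 / t ^ N) * norm (G (snd w)) = norm (H (snd w))"
      using t(1) by (simp add: norm_mult norm_divide norm_power)
  qed
  finally have "(\<lambda>w. H (snd w)) summable_on S2"
    by (rule abs_summable_summable)
  then obtain S where S: "((\<lambda>w. H (snd w)) has_sum S) S2"
    by (auto simp: summable_on_def)

  define b where "b C = ((x * s) ^ C * qpoch q (y / (x * s)) C * qexp_coeff q C) *
    (y ^ (N + C) * qpoch q (x / s / y) (N + C) * qexp_coeff q (N + C))" for C
  have fin: "finite {(m, i). m + i = C}" for C :: nat
    by (rule finite_subset[of _ "{..C} \<times> {..C}"]) auto
  have "(b has_sum S) UNIV"
  proof (rule has_sum_SigmaD[OF S[unfolded S2_def]])
    fix C
    show "((\<lambda>z. H (snd (C, z))) has_sum b C) ({(m, i). m + i = C} \<times> {(p, j). p + j = N + C})"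
      using has_sum_times[OF summable_on_finite[OF fin] summable_on_finite[OF fin]
        finite_q_binomial_homogeneous[of "x * s" y C]
        finite_q_binomial_homogeneous[of y "x / s" "N + C"]] nz
      by (simp add: H_def b_def case_prod_unfold)
  qed
  then have b: "b sums S" by (rule has_sum_imp_sums)

  define c where "c = y ^ N * (qpoch q (x / s / y) N / qpoch q (of_real q) N)"
  define r where "r C = qpoch q (y / (x * s)) C * qpoch q (of_real q ^ N * (x / s / y)) C /
      (qpoch q (of_real q ^ Suc N) C * qpoch q (of_real q) C) * (s * x * y) ^ C" for C
  have "b = (\<lambda>C. c * r C)"
    \<comment> \<open>Splitting every \<open>qpoch\<close> of length \<open>N + C\<close> after
      \<open>N\<close> factors separates the constant \<open>c\<close>.\<close>
    by (rule ext) (simp add: b_def c_def r_def qexp_coeff_def qpoch_add power_add power_mult_distrib mult_ac)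
  with b have "S = c * suminf r"
    \<comment> \<open>Summability of \<open>r\<close> follows from that of \<open>b\<close> only
      when \<open>c\<close> can be cancelled; for \<open>c = 0\<close> both sides are 0.\<close>
    by (cases "c = 0") (auto simp: sums_iff summable_cmult_iff suminf_mult)
  then have "S = c * phi21 (y / (x * s)) (of_real q ^ N * (x / s / y)) (of_real q ^ Suc N) q (s * x * y)"
    by (simp only: phi21_def r_def[abs_def])

  moreover have "((\<lambda>k. s powi k * (qbessel q k x * qbessel q (int N + k) y)) has_sum S) UNIV"
  proof -
    let ?f = "\<lambda>x (m, j). x ^ m * qexp_coeff q m * (x ^ j * qExp_coeff q j)"
    let ?F = "\<lambda>(k, (u, v)). s powi k * (?f x u * ?f y v)"
    \<comment> \<open>The powers of \<open>s\<close> agree since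
      \<open>(x s)^m (x / s)^j = s^(m-j) x^(m+j)\<close>.\<close>
    have "(?F has_sum S) S1 \<longleftrightarrow> ((\<lambda>w. H (snd w)) has_sum S) S2"
      by (rule has_sum_reindex_bij_witness[of _
          "\<lambda>(C, (m, i), (p, j)). (int m - int j, (m, j), (p, i))"
          "\<lambda>(k, (m, j), (p, i)). (m + i, (m, i), (p, j))"])
         (use nz in \<open>auto simp: S1_def S2_def H_def power_int_diff power_mult_distrib power_divide\<close>)
    with S have F: "(?F has_sum S)
        (Sigma UNIV (\<lambda>k. {(m, j). int m - int j = k} \<times> {(p, i). int p - int i = int N + k}))"
      by (simp add: S1_def)
    have "((\<lambda>z. ?F (k, z)) has_sum s powi k * (qbessel q k x * qbessel q (int N + k) y))
            ({(m, j). int m - int j = k} \<times> {(p, i). int p - int i = int N + k})" for k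
      using has_sum_cmult_right[OF has_sum_times[OF
        qbessel_has_sum(1)[OF nz(2), of k] qbessel_has_sum(1)[OF nz(3), of "int N + k"]
        qbessel_has_sum(2)[OF nz(2), of k] qbessel_has_sum(2)[OF nz(3), of "int N + k"]], of "s powi k"]
      by (simp add: case_prod_unfold)
    then show ?thesis
      by (rule has_sum_SigmaD[OF F])
  qed
  ultimately show ?thesis by (simp add: c_def)
qed

end

theorem proposition4p1:
  fixes q :: real and s x y :: complex and n :: int
  assumes "0 < q" and "q < 1"
    and "s \<noteq> 0" and "x \<noteq> 0" and "y \<noteq> 0"
    and "norm (s * x * y) < 1"
  shows "((\<lambda>k::int.
            s powi k
            * y powi (n + k)
              * (phi11_0_reg (of_real q powi (n + k + 1)) q (y\<^sup>2) / qpoch_inf q (of_real q))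
            * x powi k
              * (phi11_0_reg (of_real q powi (k + 1)) q (x\<^sup>2) / qpoch_inf q (of_real q)))
          has_sum
            (if n \<ge> 0 then
               y powi n
               * (qpoch q (inverse s * x * inverse y) (nat n) / qpoch q (of_real q) (nat n))
               * phi21 (inverse s * y * inverse x)
                       (of_real q powi n * inverse s * x * inverse y)
                       (of_real q powi (n + 1)) q (s * x * y)
             else
               s powi (- n) * x powi (- n)
               * (qpoch q (inverse s * y * inverse x) (nat (- n)) / qpoch q (of_real q) (nat (- n)))
               * phi21 (inverse s * x * inverse y)
                       (of_real q powi (- n) * inverse s * y * inverse x)
                       (of_real q powi (- n + 1)) q (s * x * y)))
         UNIV"
proof -
  have "((\<lambda>k. s powi k * (qbessel q k x * qbessel q (n + k) y)) has_sum
            (if n \<ge> 0 then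
               y powi n
               * (qpoch q (inverse s * x * inverse y) (nat n) / qpoch q (of_real q) (nat n))
               * phi21 (inverse s * y * inverse x)
                       (of_real q powi n * inverse s * x * inverse y)
                       (of_real q powi (n + 1)) q (s * x * y)
             else
               s powi (- n) * x powi (- n)
               * (qpoch q (inverse s * y * inverse x) (nat (- n)) / qpoch q (of_real q) (nat (- n)))
               * phi21 (inverse s * x * inverse y)
                       (of_real q powi (- n) * inverse s * y * inverse x)
                       (of_real q powi (- n + 1)) q (s * x * y))) UNIV"
  proof (cases "n \<ge> 0")
    case True
    then obtain N where N: "n = int N" by (metis nonneg_int_cases)
    have e: "int N + 1 = int (Suc N)" by simp
    show ?thesis
      using qbessel_convolution_nat[OF assms, of N]
      by (simp only: N e power_int_of_nat nat_int) (simp add: divide_inverse mult_ac)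
  next
    case False
    define N where "N = nat (- n)"
    have N: "n = - int N" "N > 0" using False by (auto simp: N_def)
    have e: "int N + 1 = int (Suc N)" by simp
    have "norm (s * y * x) < 1" using assms(6) by (simp add: mult_ac)
    \<comment> \<open>With \<open>x\<close> and \<open>y\<close> exchanged the orders are
      \<open>k\<close> for \<open>y\<close> and \<open>N + k\<close> for \<open>x\<close>. The
      factor \<open>s ^ N\<close> completes the power to \<open>s powi (N + k)\<close>, so that
      replacing \<open>N + k\<close> by \<open>k\<close> gives orders \<open>k\<close> for
      \<open>x\<close> and \<open>n + k\<close> for \<open>y\<close>.\<close>
    from has_sum_cmult_right[OF
        qbessel_convolution_nat[OF assms(1-3) assms(5,4) this, of N], of "s ^ N"]
    have "((\<lambda>k. s powi (int N + k) * (qbessel q k y * qbessel q (int N + k) x)) has_sum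
        s ^ N * (x ^ N * (qpoch q (y / s / x) N / qpoch q (of_real q) N)
             * phi21 (x / (y * s)) (of_real q ^ N * (y / s / x)) (of_real q ^ Suc N) q (s * y * x))) UNIV"
      using assms(3) by (simp add: power_int_add mult.assoc)
    also have "?this \<longleftrightarrow> ((\<lambda>k. s powi k * (qbessel q k x * qbessel q (n + k) y)) has_sum
        s ^ N * (x ^ N * (qpoch q (y / s / x) N / qpoch q (of_real q) N)
             * phi21 (x / (y * s)) (of_real q ^ N * (y / s / x)) (of_real q ^ Suc N) q (s * y * x))) UNIV"
      by (rule has_sum_reindex_bij_witness[of _ "\<lambda>k. k - int N" "\<lambda>k. int N + k"])
         (auto simp: N(1))
    finally show ?thesis
      using N(2)
      by (simp only: N(1) minus_minus e power_int_of_nat nat_int) (simp add: divide_inverse mult_ac)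
  qed
  then show ?thesis
    by (simp add: qbessel_def mult_ac)
qed

end
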